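(* For any two positive integers $k$ and $n$ such that $k$ divides $n$, there exists a connected trivially perfect graph $G$ on $n+1$ vertices such that $\mathit{td}(G)=n/k+1$ and $\delta(\mathcal{A}(G))\ge \mathit{td}(G)\cdot n/2$.
   Context: For a connected graph $G=(V,E)$, a search tree on $G$ is a rooted tree with vertex set $V$ defined recursively: its root is some vertex $r\in V$, and $r$ is joined to the roots of search trees on each connected component of $G-r$. The tubes of a search tree are the vertex sets of its subtrees. Two search trees on $G$ are related by a rotation if their sets of tubes have symmetric difference of size exactly two. The graph associahedron $\mathcal{A}(G)$ is a polytope whose skeleton is isomorphic to the graph on search trees of $G$ with adjacency given by rotations; $\delta(\mathcal{A}(G))$ is the diameter of this graph. The tree-depth $\mathit{td}(G)$ is the minimum height of a search tree on $G$, where a single vertex has height one. A graph is trivially perfect if it can be built recursively from single vertices by (i) adding a new vertex adjacent to all existing vertices and (ii) taking disjoint unions of two trivially perfect graphs. *)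

theory Defs
  imports "Graph_Theory.Graph_Theory" "HOL-Library.FSet"
begin

text \<open>
  Simple graphs are symmetric, loop-free, finite digraphs (locale \<^locale>\<open>pair_graph\<close>). For such
  graphs the strongly connected components are exactly the connected components.
\<close>

datatype (tree_verts: 'a) rtree = Node (root: 'a) (children: "'a rtree fset")

text \<open>The function \<open>f\<close> assigns to each connected component of \<open>G - r\<close> a search tree on it.\<close>

inductive search_tree :: "('a, 'b) pre_digraph \<Rightarrow> 'a rtree \<Rightarrow> bool" where
  "\<lbrakk> r \<in> verts G;
     \<forall>C \<in> pre_digraph.sccs (pre_digraph.del_vert G r). search_tree C (f C);
     fset ts = f ` pre_digraph.sccs (pre_digraph.del_vert G r) \<rbrakk>
   \<Longrightarrow> search_tree G (Node r ts)"

primrec subtrees :: "'a rtree \<Rightarrow> 'a rtree set" where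
  "subtrees (Node r ts) = insert (Node r ts) (\<Union> (fset (subtrees |`| ts)))"

primrec height :: "'a rtree \<Rightarrow> nat" where
  "height (Node r ts) = Suc (Max (insert 0 (fset (height |`| ts))))"

definition tubes :: "'a rtree \<Rightarrow> 'a set set" where
  "tubes T = tree_verts ` subtrees T"

definition tree_depth :: "('a, 'b) pre_digraph \<Rightarrow> nat" where
  "tree_depth G = (LEAST h. \<exists>T. search_tree G T \<and> height T = h)"

definition rotation :: "'a rtree \<Rightarrow> 'a rtree \<Rightarrow> bool" where
  "rotation S T \<longleftrightarrow> card ((tubes S - tubes T) \<union> (tubes T - tubes S)) = 2"

definition rotation_graph :: "('a, 'b) pre_digraph \<Rightarrow> 'a rtree pair_pre_digraph" where
  "rotation_graph G =
     \<lparr> pverts = {T. search_tree G T},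
       parcs = {(S, T). search_tree G S \<and> search_tree G T \<and> rotation S T} \<rparr>"

lemma pair_wf_digraph_rotation_graph: "pair_wf_digraph (rotation_graph G)"
  by unfold_locales (auto simp: rotation_graph_def)

text \<open>
  With all arc costs equal to 1, \<open>\<mu>\<close> is the usual distance (the least number of arcs of a walk,
  and \<open>\<infinity>\<close> if there is none).
\<close>

definition graph_diameter :: "('a, 'b) pre_digraph \<Rightarrow> ereal" where
  "graph_diameter G = (SUP u \<in> verts G. SUP v \<in> verts G. wf_digraph.\<mu> G (\<lambda>_. 1) u v)"

text \<open>
  The skeleton of the graph associahedron of \<open>G\<close> is the rotation graph, so its diameter is
  \<open>\<delta>(\<A>(G))\<close>.
\<close>

definition associahedron_diameter :: "('a, 'b) pre_digraph \<Rightarrow> ereal" where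
  "associahedron_diameter G = graph_diameter (with_proj (rotation_graph G))"

inductive trivially_perfect :: "'a pair_pre_digraph \<Rightarrow> bool" where
  single_vertex: "trivially_perfect \<lparr> pverts = {v}, parcs = {} \<rparr>"
| add_universal_vertex:
    "\<lbrakk> trivially_perfect G; v \<notin> pverts G \<rbrakk> \<Longrightarrow>
     trivially_perfect
       \<lparr> pverts = insert v (pverts G),
         parcs = parcs G \<union> {v} \<times> pverts G \<union> pverts G \<times> {v} \<rparr>"
| disjoint_union:
    "\<lbrakk> trivially_perfect G; trivially_perfect H; pverts G \<inter> pverts H = {} \<rbrakk> \<Longrightarrow>
     trivially_perfect \<lparr> pverts = pverts G \<union> pverts H, parcs = parcs G \<union> parcs H \<rparr>"

end

theory Submission
  imports Defs
begin

text \<open>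
  The two ends of an edge of \<open>G\<close> are always comparable in a search tree, so a search tree orients
  every edge from its upper to its lower end. A rotation reverses the orientation of a single edge,
  the one between the two vertices being rotated. Hence two search trees that orient all edges in
  opposite ways, obtained by choosing roots according to a linear order and to its reverse, are at
  distance at least the number of edges of \<open>G\<close>. For the graph made of \<open>k\<close> disjoint cliques of size
  \<open>m = n / k\<close> and a universal vertex, the tree-depth is \<open>m + 1\<close> and the number of edges is
  \<open>k m (m - 1) / 2 + n = (m + 1) n / 2\<close>.
\<close>

section \<open>Components after deleting a vertex\<close>

lemma symmetric_arcs_endsD:
  assumes "pseudo_graph G" "(u, v) \<in> arcs_ends G"
  shows "(v, u) \<in> arcs_ends G"
proof -
  interpret pseudo_graph G by fact
  show ?thesis using assms(2) by (rule graph_symmetric)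
qed

lemma arcs_ends_verts:
  assumes "pseudo_graph G" "(u, v) \<in> arcs_ends G"
  shows "u \<in> verts G" "v \<in> verts G"
proof -
  interpret pseudo_graph G by fact
  show "u \<in> verts G" "v \<in> verts G" using assms(2) by (auto dest: adj_in_verts)
qed

lemma finite_arcs_ends: "pseudo_graph G \<Longrightarrow> finite (arcs_ends G)"
  by (simp add: arcs_ends_def fin_digraph.finite_arcs pseudo_graph_def)

lemma finite_verts_pseudo: "pseudo_graph G \<Longrightarrow> finite (verts G)"
  by (simp add: fin_digraph.finite_verts pseudo_graph_def)

lemma pseudo_graph_induced_subgraph:
  assumes "pseudo_graph G" "induced_subgraph H G"
  shows "pseudo_graph H"
proof -
  interpret pseudo_graph G by fact
  have sub: "subgraph H G" using assms(2) by (rule induced_imp_subgraph)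
  have "fin_digraph H" using sub by (rule fin_digraph_subgraph)
  moreover have "symmetric H"
    using assms(2) by (rule induced_graph_imp_symmetric[OF sym_arcs])
  ultimately show ?thesis
    by (simp add: pseudo_graph_def sym_digraph_def sym_digraph_axioms_def fin_digraph_def)
qed

abbreviation components :: "('a, 'b) pre_digraph \<Rightarrow> 'a \<Rightarrow> ('a, 'b) pre_digraph set" where
  "components G r \<equiv> pre_digraph.sccs (pre_digraph.del_vert G r)"

lemma arcs_ends_del_vert:
  "arcs_ends (pre_digraph.del_vert G r) = {(u, v) \<in> arcs_ends G. u \<noteq> r \<and> v \<noteq> r}"
  by (auto simp: arcs_ends_conv pre_digraph.del_vert_def)

context
  fixes G :: "('a, 'b) pre_digraph" and r :: 'a
  assumes G: "pseudo_graph G"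
begin

lemma pseudo_graph_del_vert: "pseudo_graph (pre_digraph.del_vert G r)"
proof -
  interpret pseudo_graph G by fact
  have "symmetric (pre_digraph.del_vert G r)"
    using sym_arcs by (auto simp: symmetric_def arcs_ends_del_vert sym_def)
  then show ?thesis using fin_digraph_del_vert[of r]
    by (simp add: pseudo_graph_def sym_digraph_def sym_digraph_axioms_def fin_digraph_def)
qed

interpretation D: pseudo_graph "pre_digraph.del_vert G r"
  by (rule pseudo_graph_del_vert)

lemma pseudo_graph_component: "C \<in> components G r \<Longrightarrow> pseudo_graph C"
  using pseudo_graph_induced_subgraph[OF pseudo_graph_del_vert] by (auto simp: D.sccs_def)

lemma component_nonempty: "C \<in> components G r \<Longrightarrow> verts C \<noteq> {}"
  by (auto simp: D.sccs_def strongly_connected_def)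

lemma component_arcs_ends:
  assumes "C \<in> components G r"
  shows "arcs_ends C \<subseteq> {(u, v) \<in> arcs_ends G. u \<noteq> r \<and> v \<noteq> r}"
  using arcs_ends_mono[of C "pre_digraph.del_vert G r"] assms arcs_ends_del_vert[of G r]
  by (auto simp: D.sccs_def dest: induced_imp_subgraph)

lemma component_disjoint:
  assumes "C \<in> components G r" "D \<in> components G r" "x \<in> verts C" "x \<in> verts D"
  shows "C = D"
  using D.scc_disj[of C D] assms by auto

lemma Union_components: "(\<Union>C\<in>components G r. verts C) = verts G - {r}"
proof -
  have "verts C \<subseteq> verts G - {r}" if "C \<in> components G r" for C
    using that by (auto simp: D.sccs_def pre_digraph.verts_del_vert
        dest!: induced_imp_subgraph subgraph_imp_subverts)
  moreover have "\<exists>C\<in>components G r. x \<in> verts C" if "x \<in> verts G - {r}" for x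
    using D.scc_for_vert_ex[of x] that by (auto simp: pre_digraph.verts_del_vert)
  ultimately show ?thesis by blast
qed

text \<open>In a symmetric digraph no arc joins two different strongly connected components, so what
  remains after deleting \<open>r\<close> is the union of its components.\<close>

lemma component_edge:
  assumes "(u, v) \<in> arcs_ends G" "u \<noteq> r" "v \<noteq> r"
  obtains C where "C \<in> components G r" "(u, v) \<in> arcs_ends C"
proof -
  from assms have "(u, v) \<in> arcs_ends (pre_digraph.del_vert G r)"
    by (simp add: arcs_ends_del_vert)
  then have "(u, v) \<in> arcs_ends (D.Union D.sccs)"
    by (simp only: D.graph_is_union_sccs)
  then obtain a C where a: "C \<in> D.sccs" "a \<in> arcs C"
      "u = tail (pre_digraph.del_vert G r) a" "v = head (pre_digraph.del_vert G r) a"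
    by (auto simp: arcs_ends_conv D.Union_def)
  \<comment> \<open>A component inherits the tail and head maps, so the arc keeps its ends
    there.\<close>
  then have "compatible (pre_digraph.del_vert G r) C"
    by (auto simp: D.sccs_def dest: induced_imp_subgraph)
  with a have "(u, v) \<in> arcs_ends C"
    by (auto simp: arcs_ends_conv compatible_def)
  with a show ?thesis using that by blast
qed

lemma finite_components: "finite (components G r)"
  using D.finite_sccs_verts by (simp add: D.sccs_conv_sccs_verts)

text \<open>Children are stored in a finite set; finitely many components ensure that
  \<open>Abs_fset\<close> represents the intended image.\<close>

lemma search_tree_children_exist:
  assumes "r \<in> verts G" "\<forall>C\<in>components G r. search_tree C (f C)"
  obtains ts where "search_tree G (Node r ts)" "fset ts = f ` components G r"
proof -
  have "fset (Abs_fset (f ` components G r)) = f ` components G r"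
    using finite_components by (simp add: Abs_fset_inverse)
  then show ?thesis using that search_tree.intros[OF assms] by blast
qed

end

lemma tree_verts_search_tree:
  assumes "search_tree G T" "pseudo_graph G"
  shows "tree_verts T = verts G"
  using assms
proof (induction rule: search_tree.induct)
  case (1 r G f ts)
  then show ?case
    using Union_components[of G r] pseudo_graph_component[of G _ r] by auto
qed

section \<open>Height\<close>

lemma height_Node_le_iff: "height (Node r ts) \<le> Suc h \<longleftrightarrow> (\<forall>t\<in>fset ts. height t \<le> h)"
  by auto

lemma height_child_less: "t \<in> fset ts \<Longrightarrow> height t < height (Node r ts)"
  using height_Node_le_iff[of r ts "height (Node r ts) - 1"] by (auto simp: less_Suc_eq_le)

text \<open>Each level uses up its root, and every component lies among the remaining vertices. This
  will bound the height inside one block.\<close>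

lemma height_le_card:
  assumes "search_tree G T" "pseudo_graph G"
  shows "height T \<le> card (verts G)"
  using assms
proof (induction rule: search_tree.induct)
  case (1 r G f ts)
  note G = \<open>pseudo_graph G\<close>
  have fin: "finite (verts G)" using G by (rule finite_verts_pseudo)
  have "height (f C) \<le> card (verts G - {r})" if C: "C \<in> components G r" for C
  proof -
    have "verts C \<subseteq> verts G - {r}"
      using C Union_components[OF G, of r] by blast
    then have "card (verts C) \<le> card (verts G - {r})"
      using fin by (intro card_mono) simp_all
    moreover have "height (f C) \<le> card (verts C)"
      using 1(3)[THEN bspec, OF C, THEN conjunct2] pseudo_graph_component[OF G C] by (rule mp)
    ultimately show ?thesis by simp
  qed
  then have "height (Node r ts) \<le> Suc (card (verts G - {r}))"
    unfolding height_Node_le_iff 1(2) by simp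
  then show ?case unfolding card_Suc_Diff1[OF fin 1(1)] .
qed

text \<open>Deleting the root costs a clique at most one vertex, and the rest stays within a single
  component, hence within a single child. This yields the lower bound on tree-depth.\<close>

lemma card_clique_le_height:
  assumes "search_tree G T" "pseudo_graph G"
    and "K \<subseteq> verts G" "\<And>u v. u \<in> K \<Longrightarrow> v \<in> K \<Longrightarrow> u \<noteq> v \<Longrightarrow> (u, v) \<in> arcs_ends G"
  shows "card K \<le> height T"
  using assms
proof (induction arbitrary: K rule: search_tree.induct)
  case (1 r G f ts)
  note G = \<open>pseudo_graph G\<close> and K = \<open>K \<subseteq> verts G\<close> and clique = 1(6)
  have fin: "finite K" using K finite_verts_pseudo[OF G] by (rule finite_subset)
  show ?case
  proof (cases "K - {r} = {}")
    case True
    then have "card K \<le> card {r}" by (intro card_mono) auto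
    then show ?thesis by simp
  next
    case False
    then obtain x where x: "x \<in> K" "x \<noteq> r" by auto
    then obtain C where C: "C \<in> components G r" "x \<in> verts C"
      using Union_components[OF G, of r] K by blast
    note C' = pseudo_graph_component[OF G C(1)]
    \<comment> \<open>A clique edge avoiding \<open>r\<close> lies in some component; sharing
      \<open>u\<close> with \<open>C\<close>, that component must be \<open>C\<close>.\<close>
    have edge: "(u, v) \<in> arcs_ends C"
      if uv: "u \<in> K" "v \<in> K" "u \<noteq> v" "u \<noteq> r" "v \<noteq> r" and u: "u \<in> verts C" for u v
    proof -
      obtain D where D: "D \<in> components G r" "(u, v) \<in> arcs_ends D"
        using component_edge[OF G clique[OF uv(1-3)] uv(4,5)] .
      have "u \<in> verts D"
        using arcs_ends_verts(1)[OF pseudo_graph_component[OF G D(1)] D(2)] .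
      then have "D = C" using component_disjoint[OF G D(1) C(1) _ u] by blast
      then show ?thesis using D(2) by simp
    qed
    have sub: "K - {r} \<subseteq> verts C"
    proof
      fix v assume v: "v \<in> K - {r}"
      show "v \<in> verts C"
      proof (cases "v = x")
        case False
        then show ?thesis
          using arcs_ends_verts(2)[OF C' edge[of x v]] v x C(2) by simp
      qed (simp add: C)
    qed
    have IH: "card L \<le> height (f C)"
      if "L \<subseteq> verts C" "\<And>u v. u \<in> L \<Longrightarrow> v \<in> L \<Longrightarrow> u \<noteq> v \<Longrightarrow> (u, v) \<in> arcs_ends C" for L
      using 1(3)[THEN bspec, OF C(1), THEN conjunct2] C' that by simp
    have "card (K - {r}) \<le> height (f C)"
    proof (rule IH[OF sub])
      fix u v assume "u \<in> K - {r}" "v \<in> K - {r}" "u \<noteq> v"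
      then show "(u, v) \<in> arcs_ends C" using edge[of u v] sub by auto
    qed
    also have "\<dots> < height (Node r ts)"
      using C(1) 1(2) by (intro height_child_less) simp
    finally show ?thesis
      using fin by (cases "r \<in> K") (simp_all add: card_Diff_singleton)
  qed
qed

section \<open>Tubes and the orientation of edges\<close>

text \<open>The set \<open>\<tau> v\<close> is the tube rooted at \<open>v\<close>, so \<open>u \<in> \<tau> v\<close> says that \<open>v\<close> is a weak ancestor of \<open>u\<close>.\<close>

locale tubing =
  fixes E :: "'a rel" and V :: "'a set" and Q :: "'a set set" and \<tau> :: "'a \<Rightarrow> 'a set"
  assumes tubes_eq: "Q = \<tau> ` V"
    and self: "v \<in> V \<Longrightarrow> v \<in> \<tau> v"
    and tube_verts: "v \<in> V \<Longrightarrow> \<tau> v \<subseteq> V"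
    and trans: "v \<in> V \<Longrightarrow> u \<in> \<tau> v \<Longrightarrow> \<tau> u \<subseteq> \<tau> v"
    and antisym: "u \<in> V \<Longrightarrow> v \<in> V \<Longrightarrow> u \<in> \<tau> v \<Longrightarrow> v \<in> \<tau> u \<Longrightarrow> u = v"
    and laminar: "u \<in> V \<Longrightarrow> v \<in> V \<Longrightarrow> x \<in> \<tau> u \<Longrightarrow> x \<in> \<tau> v \<Longrightarrow> u \<in> \<tau> v \<or> v \<in> \<tau> u"
    and edge_verts: "(u, v) \<in> E \<Longrightarrow> u \<in> V \<and> v \<in> V"
    and edge_comparable: "(u, v) \<in> E \<Longrightarrow> u \<in> \<tau> v \<or> v \<in> \<tau> u"

text \<open>On an edge \<open>(x, y)\<close>, separation by a tube means that \<open>x\<close> is above \<open>y\<close>. Unlike the ancestor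
  relation, it is determined by the set of tubes alone.\<close>

definition separated :: "'a set set \<Rightarrow> 'a rel" where
  "separated Q = {(x, y). \<exists>A\<in>Q. y \<in> A \<and> x \<notin> A}"

context tubing
begin

lemma inj_on_tube: "inj_on \<tau> V"
proof (rule inj_onI)
  fix u v assume "u \<in> V" "v \<in> V" "\<tau> u = \<tau> v"
  then show "u = v" using self[of u] self[of v] antisym[of u v] by simp
qed

text \<open>Hence all search trees on one graph have equally many tubes, and a rotation trades
  exactly one tube for another.\<close>

lemma card_tubes: "card Q = card V"
  by (simp add: tubes_eq card_image inj_on_tube)

text \<open>The ends are comparable. If \<open>x\<close> were in \<open>\<tau> y\<close>,
  transitivity would put \<open>x\<close> into every tube containing \<open>y\<close>, and nothing
  could separate them.\<close>

lemma separated_edgeD: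
  assumes "(x, y) \<in> E" "(x, y) \<in> separated Q"
  shows "y \<in> \<tau> x" "x \<noteq> y"
  using assms edge_comparable[of x y] trans tubes_eq by (auto simp: separated_def)

lemma separated_asym: "(x, y) \<in> E \<Longrightarrow> (x, y) \<in> separated Q \<Longrightarrow> (y, x) \<in> E \<Longrightarrow> (y, x) \<notin> separated Q"
  using separated_edgeD[of x y] separated_edgeD[of y x] antisym edge_verts by blast

text \<open>If a single tube is exchanged, the only arc whose orientation can change is the one from the
  parent of the root of the removed tube.\<close>

lemma separated_lost_unique:
  assumes "Q - Q' \<subseteq> {B}"
    and "(x, y) \<in> E" "(x, y) \<in> separated Q" "(x, y) \<notin> separated Q'"
    and "(x', y') \<in> E" "(x', y') \<in> separated Q" "(x', y') \<notin> separated Q'"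
  shows "(x, y) = (x', y')"
proof -
  \<comment> \<open>A tube containing \<open>v\<close> but not \<open>u\<close> would still separate
    them in \<open>Q'\<close>, so it is the removed tube.\<close>
  have only: "\<tau> w = B" if "w \<in> V" "v \<in> \<tau> w" "u \<notin> \<tau> w" "(u, v) \<notin> separated Q'" for w u v
    using that assms(1) by (auto simp: separated_def tubes_eq)
  let ?lost = "\<lambda>u v. (u, v) \<in> E \<and> (u, v) \<in> separated Q \<and> (u, v) \<notin> separated Q'"
  have lost: "u \<in> V" "v \<in> V" "v \<in> \<tau> u" "u \<noteq> v" "\<tau> v = B" if "?lost u v" for u v
  proof -
    show uv: "u \<in> V" "v \<in> V" "v \<in> \<tau> u" "u \<noteq> v"
      using that edge_verts[of u v] separated_edgeD[of u v] by auto
    then have "u \<notin> \<tau> v" using antisym by blast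
    then show "\<tau> v = B" using only[of v v u] self uv(2) that by simp
  qed
  have xy: "?lost x y" and x'y': "?lost x' y'" using assms by simp_all
  \<comment> \<open>Both lower ends are the root of \<open>B\<close>, which is unique by
    injectivity.\<close>
  have y: "y = y'"
    using lost(2,5)[OF xy] lost(2,5)[OF x'y'] inj_on_tube by (simp add: inj_on_def)
  \<comment> \<open>If \<open>u\<close> were strictly below \<open>u'\<close>, the tube of
    \<open>u\<close> would contain \<open>y\<close> but not \<open>u'\<close>, so it too would be
    \<open>B\<close>, the tube of \<open>y\<close>, forcing \<open>u = y\<close>.\<close>
  have nested: "u = u'" if u: "?lost u y" and u': "?lost u' y" and sub: "u \<in> \<tau> u'" for u u'
  proof (rule ccontr)
    assume "u \<noteq> u'"
    then have "u' \<notin> \<tau> u" using sub antisym lost(1)[OF u] lost(1)[OF u'] by blast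
    then have "\<tau> u = B" using only[of u y u'] lost(1,3)[OF u] u' by simp
    then have "\<tau> u = \<tau> y" using lost(5)[OF u] by simp
    then show False using inj_on_tube lost(1,2,4)[OF u] by (simp add: inj_on_def)
  qed
  \<comment> \<open>Both upper ends are ancestors of the common lower end, so laminarity makes them
    comparable.\<close>
  have "x \<in> \<tau> x' \<or> x' \<in> \<tau> x"
    using laminar[of x x' y] lost(1,3)[OF xy] lost(1,3)[OF x'y'] y by simp
  then show ?thesis
    using nested[of x x'] nested[of x' x] xy x'y' y by auto
qed

end

lemma tubes_Node: "tubes (Node r ts) = insert (tree_verts (Node r ts)) (\<Union>t\<in>fset ts. tubes t)"
  by (auto simp: tubes_def)

text \<open>By induction, the tubings of the components are glued together and the whole vertex set
  becomes the tube of the root.\<close>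

lemma tubing_search_tree:
  assumes "search_tree G T" "pseudo_graph G"
  shows "\<exists>\<tau>. tubing (arcs_ends G) (verts G) (tubes T) \<tau>"
  using assms
proof (induction rule: search_tree.induct)
  case (1 r G f ts)
  note G = \<open>pseudo_graph G\<close>
  let ?CC = "components G r"
  have st: "search_tree G (Node r ts)" using 1(3) by (intro search_tree.intros[OF 1(1) _ 1(2)]) blast
  have "\<forall>C\<in>?CC. \<exists>\<tau>. tubing (arcs_ends C) (verts C) (tubes (f C)) \<tau>"
    using 1(3) pseudo_graph_component[OF G] by blast
  then obtain \<sigma> where \<sigma>: "\<And>C. C \<in> ?CC \<Longrightarrow> tubing (arcs_ends C) (verts C) (tubes (f C)) (\<sigma> C)"
    by metis
  \<comment> \<open>Components are vertex-disjoint, so the description is unique for every vertex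
    other than \<open>r\<close>.\<close>
  define comp where "comp v = (THE C. C \<in> ?CC \<and> v \<in> verts C)" for v
  have comp: "comp v = C" if "C \<in> ?CC" "v \<in> verts C" for v C
    unfolding comp_def using that component_disjoint[OF G] by blast
  define \<tau> where "\<tau> v = (if v = r then verts G else \<sigma> (comp v) v)" for v
  have sub: "verts C \<subseteq> verts G - {r}" if "C \<in> ?CC" for C
    using that Union_components[OF G, of r] by blast
  have \<tau>r: "\<tau> r = verts G" by (simp add: \<tau>_def)
  have \<tau>C: "\<tau> v = \<sigma> C v" if "C \<in> ?CC" "v \<in> verts C" for v C
    using that comp sub by (auto simp: \<tau>_def)
  have cases: "v = r \<or> (\<exists>C\<in>?CC. v \<in> verts C)" if "v \<in> verts G" for v
    using that Union_components[OF G, of r] by blast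
  \<comment> \<open>A tube rooted below \<open>r\<close> stays in one component. Each axiom thus
    reduces to the tubing of that component, apart from the cases involving
    \<open>r\<close>.\<close>
  have \<tau>sub: "\<tau> v \<subseteq> verts C" if "C \<in> ?CC" "v \<in> verts C" for v C
    using tubing.tube_verts[OF \<sigma>[OF that(1)] that(2)] \<tau>C that by simp
  have "tubing (arcs_ends G) (verts G) (tubes (Node r ts)) \<tau>"
  proof
    have "(\<Union>t\<in>fset ts. tubes t) = (\<Union>C\<in>?CC. \<sigma> C ` verts C)"
      unfolding 1(2) using tubing.tubes_eq[OF \<sigma>] by simp
    also have "\<dots> = (\<Union>C\<in>?CC. \<tau> ` verts C)" using \<tau>C by (auto simp: image_iff)
    also have "\<dots> = \<tau> ` (verts G - {r})" by (simp add: image_UN flip: Union_components[OF G])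
    finally show "tubes (Node r ts) = \<tau> ` verts G"
      unfolding tubes_Node tree_verts_search_tree[OF st G]
      using \<open>r \<in> verts G\<close> \<tau>r by auto
  next
    fix v assume "v \<in> verts G"
    then show "v \<in> \<tau> v" using cases[of v] \<tau>r \<tau>C tubing.self[OF \<sigma>] by auto
  next
    fix v assume v: "v \<in> verts G"
    then show "\<tau> v \<subseteq> verts G" using cases[of v] \<tau>r \<tau>sub sub by fastforce
  next
    fix v u assume v: "v \<in> verts G" and u: "u \<in> \<tau> v"
    show "\<tau> u \<subseteq> \<tau> v"
    proof (cases "v = r")
      case True
      then have "u \<in> verts G" using u \<tau>r by simp
      then show ?thesis using cases[of u] \<tau>r \<tau>sub sub True by fastforce
    next
      case False
      then obtain C where C: "C \<in> ?CC" "v \<in> verts C" using cases v by blast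
      then have "u \<in> verts C" using u \<tau>sub by blast
      then show ?thesis using tubing.trans[OF \<sigma>[OF C(1)] C(2), of u] u \<tau>C C by simp
    qed
  next
    fix u v assume uv: "u \<in> verts G" "v \<in> verts G" "u \<in> \<tau> v" "v \<in> \<tau> u"
    show "u = v"
    proof (cases "v = r \<or> u = r")
      case True
      then show ?thesis using uv cases[of u] cases[of v] \<tau>sub sub by blast
    next
      case False
      then obtain C where C: "C \<in> ?CC" "v \<in> verts C" using cases uv by blast
      then have "u \<in> verts C" using uv \<tau>sub by blast
      then show ?thesis using tubing.antisym[OF \<sigma>[OF C(1)], of u v] uv \<tau>C C by simp
    qed
  next
    fix u v x assume uv: "u \<in> verts G" "v \<in> verts G" "x \<in> \<tau> u" "x \<in> \<tau> v"
    show "u \<in> \<tau> v \<or> v \<in> \<tau> u"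
    proof (cases "v = r \<or> u = r")
      case True
      then show ?thesis using uv \<tau>r by auto
    next
      case False
      then obtain C D where C: "C \<in> ?CC" "v \<in> verts C" and D: "D \<in> ?CC" "u \<in> verts D"
        using cases uv by blast
      have "C = D" using component_disjoint[OF G C(1) D(1)] C D uv \<tau>sub by blast
      then show ?thesis using tubing.laminar[OF \<sigma>[OF C(1)], of u v x] uv \<tau>C C D by simp
    qed
  next
    fix u v assume "(u, v) \<in> arcs_ends G"
    then show "u \<in> verts G \<and> v \<in> verts G" using arcs_ends_verts[OF G] by blast
  next
    fix u v assume uv: "(u, v) \<in> arcs_ends G"
    show "u \<in> \<tau> v \<or> v \<in> \<tau> u"
    proof (cases "v = r \<or> u = r")
      case True
      then show ?thesis using arcs_ends_verts[OF G uv] \<tau>r by auto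
    next
      case False
      then obtain C where C: "C \<in> ?CC" "(u, v) \<in> arcs_ends C"
        using component_edge[OF G uv] by blast
      then have "u \<in> verts C" "v \<in> verts C"
        using arcs_ends_verts pseudo_graph_component[OF G] by metis+
      then show ?thesis using tubing.edge_comparable[OF \<sigma>[OF C(1)] C(2)] \<tau>C C by simp
    qed
  qed
  then show ?case by blast
qed

section \<open>Search trees with a prescribed orientation\<close>

text \<open>A vertex of greatest priority is taken as the root of every component. Ties are left
  unconstrained, so a constant priority gives mere existence of a search tree.\<close>

lemma search_tree_of_priority:
  fixes p :: "'a \<Rightarrow> 'c :: linorder"
  assumes "pseudo_graph G" "verts G \<noteq> {}"
  shows "\<exists>T. search_tree G T \<and>
    (\<forall>(x, y)\<in>arcs_ends G. p y < p x \<longrightarrow> (x, y) \<in> separated (tubes T))"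
  using assms
proof (induction "card (verts G)" arbitrary: G rule: less_induct)
  case less
  note G = \<open>pseudo_graph G\<close>
  have fin: "finite (verts G)" using G by (rule finite_verts_pseudo)
  have "Max (p ` verts G) \<in> p ` verts G" using fin less(3) by (intro Max_in) simp_all
  then obtain r where r: "r \<in> verts G" "p r = Max (p ` verts G)" by force
  have r_max: "p v \<le> p r" if "v \<in> verts G" for v
    unfolding r(2) using fin that by simp
  let ?CC = "components G r"
  have "\<forall>C\<in>?CC. \<exists>T. search_tree C T \<and>
    (\<forall>(x, y)\<in>arcs_ends C. p y < p x \<longrightarrow> (x, y) \<in> separated (tubes T))"
  proof
    fix C assume C: "C \<in> ?CC"
    then have "verts C \<subset> verts G" using Union_components[OF G, of r] r(1) by blast
    then have "card (verts C) < card (verts G)" using fin by (rule psubset_card_mono[rotated])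
    then show "\<exists>T. search_tree C T \<and>
      (\<forall>(x, y)\<in>arcs_ends C. p y < p x \<longrightarrow> (x, y) \<in> separated (tubes T))"
      using pseudo_graph_component[OF G C] component_nonempty[OF G C] by (rule less(1))
  qed
  from bchoice[OF this] obtain f where f: "\<And>C. C \<in> ?CC \<Longrightarrow> search_tree C (f C)"
    "\<And>C x y. C \<in> ?CC \<Longrightarrow> (x, y) \<in> arcs_ends C \<Longrightarrow> p y < p x \<Longrightarrow> (x, y) \<in> separated (tubes (f C))"
    by fast
  obtain ts where ts: "search_tree G (Node r ts)" "fset ts = f ` ?CC"
    using search_tree_children_exist[OF G r(1), of f] f(1) by blast
  have tubes: "tubes (f C) \<subseteq> tubes (Node r ts)" if "C \<in> ?CC" for C
    using that ts(2) by (auto simp: tubes_Node)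
  have "(x, y) \<in> separated (tubes (Node r ts))" if xy: "(x, y) \<in> arcs_ends G" "p y < p x" for x y
  proof (cases "x = r")
    case True
    \<comment> \<open>The vertex set of the component of \<open>y\<close> is a tube that omits the
      root.\<close>
    have y: "y \<in> verts G - {r}" using xy True arcs_ends_verts[OF G] by auto
    then obtain C where C: "C \<in> ?CC" "y \<in> verts C" using Union_components[OF G, of r] by blast
    have "verts C = tree_verts (f C)"
      using tree_verts_search_tree f(1)[OF C(1)] pseudo_graph_component[OF G C(1)] by metis
    then have "verts C \<in> tubes (f C)"
      by (cases "f C") (simp add: tubes_Node)
    moreover have "r \<notin> verts C" using C Union_components[OF G, of r] by blast
    ultimately show ?thesis using C tubes True by (auto simp: separated_def)
  next
    case False
    \<comment> \<open>The root has maximal priority, so it cannot be the end of smaller priority;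
      the edge therefore survives in a component.\<close>
    moreover have "y \<noteq> r" using r_max[of x] xy arcs_ends_verts[OF G xy(1)] by auto
    ultimately obtain C where C: "C \<in> ?CC" "(x, y) \<in> arcs_ends C"
      using component_edge[OF G xy(1)] by blast
    then show ?thesis using f(2)[OF C xy(2)] tubes[OF C(1)] by (auto simp: separated_def)
  qed
  then show ?case using ts(1) by blast
qed

section \<open>Orientations and rotation distance\<close>

text \<open>These are the arcs pointing downwards in \<open>T\<close>, at most one of the two for
  each edge.\<close>

definition oriented_arcs :: "('a, 'b) pre_digraph \<Rightarrow> 'a rtree \<Rightarrow> 'a rel" where
  "oriented_arcs G T = arcs_ends G \<inter> separated (tubes T)"

text \<open>The symmetric difference of size two splits evenly, so only one tube is removed, and
  removing one tube loses at most one arc.\<close>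

lemma card_oriented_arcs_diff_rotation:
  assumes "pseudo_graph G" "search_tree G S" "search_tree G T" "rotation S T"
  shows "card (oriented_arcs G S - oriented_arcs G T) \<le> 1"
proof -
  obtain \<sigma> \<tau> where S: "tubing (arcs_ends G) (verts G) (tubes S) \<sigma>"
    and T: "tubing (arcs_ends G) (verts G) (tubes T) \<tau>"
    using tubing_search_tree assms by metis
  have fin: "finite (tubes S)" "finite (tubes T)"
    using tubing.tubes_eq[OF S] tubing.tubes_eq[OF T] finite_verts_pseudo[OF assms(1)] by auto
  have "card (tubes S) = card (tubes T)"
    by (simp add: tubing.card_tubes[OF S] tubing.card_tubes[OF T])
  \<comment> \<open>Both differences remove the same intersection from finite sets of equal
    size.\<close>
  then have "card (tubes S - tubes T) = card (tubes T - tubes S)"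
    using fin card_Diff_subset_Int[of "tubes S" "tubes T"] card_Diff_subset_Int[of "tubes T" "tubes S"]
    by (simp add: Int_commute)
  moreover have "card (tubes S - tubes T) + card (tubes T - tubes S) = 2"
    using assms(4) fin unfolding rotation_def by (subst (asm) card_Un_disjoint) auto
  ultimately have "card (tubes S - tubes T) = 1" by simp
  then obtain B where "tubes S - tubes T = {B}" by (auto simp: card_1_singleton_iff)
  then have uniq: "a = b" if "a \<in> oriented_arcs G S - oriented_arcs G T"
      "b \<in> oriented_arcs G S - oriented_arcs G T" for a b
    using that tubing.separated_lost_unique[OF S, of "tubes T" B]
    by (cases a; cases b) (auto simp: oriented_arcs_def)
  show ?thesis
    using uniq finite_arcs_ends[OF assms(1)]
    by (subst One_nat_def, subst card_le_Suc0_iff_eq) (auto simp: oriented_arcs_def)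
qed

text \<open>Triangle inequality along the walk: an arc lost overall is lost in the first step or in
  the rest.\<close>

lemma card_oriented_arcs_diff_le_length:
  assumes "pseudo_graph G" "pre_digraph.awalk (with_proj (rotation_graph G)) S w T"
  shows "card (oriented_arcs G S - oriented_arcs G T) \<le> length w"
proof -
  interpret R: pair_wf_digraph "rotation_graph G" by (rule pair_wf_digraph_rotation_graph)
  have fin: "finite (oriented_arcs G T)" for T
    using finite_arcs_ends[OF assms(1)] by (simp add: oriented_arcs_def)
  show ?thesis
    using assms(2)
  proof (induction w arbitrary: S)
    case Nil
    then show ?case by (auto simp: R.awalk_def)
  next
    case (Cons e w)
    define U where "U = snd e"
    have e: "e \<in> parcs (rotation_graph G)" "e = (S, U)" and w: "R.awalk U w T"
      using Cons.prems by (simp_all add: R.awalk_Cons_iff U_def prod_eq_iff)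
    have "card (oriented_arcs G S - oriented_arcs G U) \<le> 1"
      using e by (intro card_oriented_arcs_diff_rotation[OF assms(1)]) (auto simp: rotation_graph_def)
    moreover have "card (oriented_arcs G U - oriented_arcs G T) \<le> length w"
      using w by (rule Cons.IH)
    moreover have "card (oriented_arcs G S - oriented_arcs G T) \<le>
      card ((oriented_arcs G S - oriented_arcs G U) \<union> (oriented_arcs G U - oriented_arcs G T))"
      using fin by (intro card_mono) auto
    moreover have "\<dots> \<le> card (oriented_arcs G S - oriented_arcs G U) + card (oriented_arcs G U - oriented_arcs G T)"
      by (rule card_Un_le)
    ultimately show ?case by simp
  qed
qed

text \<open>Every edge whose ends differ in priority is oriented oppositely by the trees for
  \<open>p\<close> and for \<open>- p\<close>. Integer values make the reversed order available by
  negation.\<close>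

theorem card_edges_le_associahedron_diameter:
  fixes p :: "'a \<Rightarrow> int"
  assumes "pseudo_graph G" "verts G \<noteq> {}"
  shows "ereal (real (card {(x, y) \<in> arcs_ends G. p y < p x})) \<le> associahedron_diameter G"
proof -
  interpret R: pair_wf_digraph "rotation_graph G" by (rule pair_wf_digraph_rotation_graph)
  let ?E = "{(x, y) \<in> arcs_ends G. p y < p x}"
  obtain S where S: "search_tree G S"
    "\<forall>(x, y)\<in>arcs_ends G. p y < p x \<longrightarrow> (x, y) \<in> separated (tubes S)"
    using search_tree_of_priority[OF assms, of p] by blast
  obtain T where T: "search_tree G T"
    "\<forall>(x, y)\<in>arcs_ends G. - p y < - p x \<longrightarrow> (x, y) \<in> separated (tubes T)"
    using search_tree_of_priority[OF assms, of "\<lambda>x. - p x"] by blast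
  obtain \<tau> where \<tau>: "tubing (arcs_ends G) (verts G) (tubes T) \<tau>"
    using tubing_search_tree[OF T(1) assms(1)] ..
  have flipped: "?E \<subseteq> oriented_arcs G S - oriented_arcs G T"
  proof clarify
    fix x y assume xy: "(x, y) \<in> arcs_ends G" "p y < p x"
    \<comment> \<open>\<open>T\<close> orients the edge from \<open>y\<close> down to
      \<open>x\<close>, and antisymmetry excludes the other direction.\<close>
    have yx: "(y, x) \<in> arcs_ends G" using symmetric_arcs_endsD[OF assms(1) xy(1)] .
    then have "(y, x) \<in> separated (tubes T)" using T(2) xy(2) by fastforce
    then have "(x, y) \<notin> separated (tubes T)" using tubing.separated_asym[OF \<tau> yx] xy by blast
    then show "(x, y) \<in> oriented_arcs G S - oriented_arcs G T"
      using S(2) xy by (auto simp: oriented_arcs_def)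
  qed
  \<comment> \<open>The distance is an infimum over walks, so it suffices to bound each walk;
    without any walk it is infinite.\<close>
  have "ereal (real (card ?E)) \<le> R.\<mu> (\<lambda>_. 1) S T"
    unfolding R.\<mu>_def
  proof (rule INF_greatest)
    fix w assume "w \<in> {w. R.awalk S w T}"
    then have "card (oriented_arcs G S - oriented_arcs G T) \<le> length w"
      using card_oriented_arcs_diff_le_length[OF assms(1)] by simp
    moreover have "card ?E \<le> card (oriented_arcs G S - oriented_arcs G T)"
      using flipped finite_arcs_ends[OF assms(1)]
      by (intro card_mono) (auto simp: oriented_arcs_def)
    moreover have "R.awalk_cost (\<lambda>_. 1) w = length w"
      by (induction w) auto
    ultimately show "ereal (real (card ?E)) \<le> ereal (R.awalk_cost (\<lambda>_. 1) w)" by simp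
  qed
  also have "\<dots> \<le> associahedron_diameter G"
    unfolding associahedron_diameter_def graph_diameter_def
    using S(1) T(1) by (intro SUP_upper2[of S] SUP_upper2[of T]) (auto simp: rotation_graph_def)
  finally show ?thesis .
qed

section \<open>Disjoint cliques with a universal vertex\<close>

text \<open>A complete graph arises from a single vertex by repeatedly adding universal
  vertices.\<close>

lemma trivially_perfect_complete:
  assumes "finite S" "S \<noteq> {}"
  shows "trivially_perfect \<lparr>pverts = S, parcs = {(u, v). u \<in> S \<and> v \<in> S \<and> u \<noteq> v}\<rparr>"
  using assms
proof (induction rule: finite_ne_induct)
  case (singleton v)
  have no_arcs: "{(u, w). u \<in> {v} \<and> w \<in> {v} \<and> u \<noteq> w} = {}" by auto
  show ?case unfolding no_arcs by (rule single_vertex)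
next
  case (insert v S)
  have arcs: "{(u, w). u \<in> insert v S \<and> w \<in> insert v S \<and> u \<noteq> w} =
    {(u, w). u \<in> S \<and> w \<in> S \<and> u \<noteq> w} \<union> {v} \<times> S \<union> S \<times> {v}"
    using \<open>v \<notin> S\<close> by auto
  show ?case
    using add_universal_vertex[OF insert.IH, of v] \<open>v \<notin> S\<close>
    unfolding arcs pair_pre_digraph.select_convs by blast
qed

text \<open>Translates between adjacency by equal quotients and blocks as intervals.\<close>

lemma div_eq_iff_block:
  fixes m :: nat
  assumes "m > 0"
  shows "i div m = j \<longleftrightarrow> i \<in> {j * m..<Suc j * m}"
  using assms by (auto simp: div_nat_eqI mult.commute dividend_less_times_div)

text \<open>One clique is added at a time by disjoint union. The count is \<open>Suc j\<close> since
  the empty graph is not trivially perfect.\<close>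

lemma trivially_perfect_blocks:
  assumes "m > 0"
  shows "trivially_perfect \<lparr>pverts = {..<Suc j * m},
    parcs = {(u, v). u < Suc j * m \<and> v < Suc j * m \<and> u div m = v div m \<and> u \<noteq> v}\<rparr>"
proof (induction j)
  case 0
  have "{(u, v). u < m \<and> v < m \<and> u div m = v div m \<and> u \<noteq> v} =
    {(u, v). u \<in> {..<m} \<and> v \<in> {..<m} \<and> u \<noteq> v}" by auto
  then show ?case using trivially_perfect_complete[of "{..<m}"] assms by (simp add: lessThan_empty_iff)
next
  case (Suc j)
  let ?S = "{Suc j * m..<Suc (Suc j) * m}"
  have S: "u \<in> ?S \<longleftrightarrow> u div m = Suc j" for u
    using div_eq_iff_block[OF assms] by blast
  have less: "u < i * m \<longleftrightarrow> u div m < i" for u i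
    using assms by (simp add: less_mult_imp_div_less div_less_iff_less_mult)
  have "trivially_perfect \<lparr>pverts = ?S, parcs = {(u, v). u \<in> ?S \<and> v \<in> ?S \<and> u \<noteq> v}\<rparr>"
    using assms by (intro trivially_perfect_complete) auto
  from disjoint_union[OF Suc.IH this, unfolded pair_pre_digraph.select_convs]
  have union: "trivially_perfect \<lparr>pverts = {..<Suc j * m} \<union> ?S,
    parcs = {(u, v). u < Suc j * m \<and> v < Suc j * m \<and> u div m = v div m \<and> u \<noteq> v} \<union>
      {(u, v). u \<in> ?S \<and> v \<in> ?S \<and> u \<noteq> v}\<rparr>"
    by fastforce
  have verts: "{..<Suc j * m} \<union> ?S = {..<Suc (Suc j) * m}" by auto
  have arcs: "{(u, v). u < Suc j * m \<and> v < Suc j * m \<and> u div m = v div m \<and> u \<noteq> v} \<union>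
      {(u, v). u \<in> ?S \<and> v \<in> ?S \<and> u \<noteq> v} =
    {(u, v). u < Suc (Suc j) * m \<and> v < Suc (Suc j) * m \<and> u div m = v div m \<and> u \<noteq> v}"
    unfolding S less by auto
  show ?case using union unfolding verts arcs .
qed

text \<open>Applied to the quotient by \<open>m\<close>, this confines each component left by the
  universal vertex to one block.\<close>

lemma invariant_on_strongly_connected:
  assumes "strongly_connected C" "pseudo_graph C" "x \<in> verts C" "y \<in> verts C"
    and "\<And>u v. (u, v) \<in> arcs_ends C \<Longrightarrow> g u = g v"
  shows "g x = g y"
proof -
  interpret pseudo_graph C by fact
  have "x \<rightarrow>\<^sup>*\<^bsub>C\<^esub> y" using assms by (auto simp: strongly_connected_def)
  then show ?thesis by (induction rule: reachable_induct) (auto dest: assms(5))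
qed

text \<open>For positive \<open>m\<close>, vertex \<open>n\<close> is the apex of a cone over
  cliques on consecutive blocks of \<open>m\<close> numbers; all blocks are full when
  \<open>m\<close> divides \<open>n\<close>.\<close>

definition coned_cliques :: "nat \<Rightarrow> nat \<Rightarrow> nat pair_pre_digraph" where
  "coned_cliques m n = \<lparr>pverts = {..n},
     parcs = {(u, v). u \<le> n \<and> v \<le> n \<and> u \<noteq> v \<and> (u = n \<or> v = n \<or> u div m = v div m)}\<rparr>"

lemma pair_graph_coned_cliques: "pair_graph (coned_cliques m n)"
proof
  have "parcs (coned_cliques m n) \<subseteq> {..n} \<times> {..n}" by (auto simp: coned_cliques_def)
  then show "finite (parcs (coned_cliques m n))" by (rule finite_subset) simp
qed (auto simp: coned_cliques_def symmetric_def sym_def)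

lemma pseudo_graph_coned_cliques: "pseudo_graph (with_proj (coned_cliques m n))"
proof -
  interpret pair_graph "coned_cliques m n" by (rule pair_graph_coned_cliques)
  show ?thesis by (rule pseudo_graph_axioms)
qed

lemma connected_coned_cliques: "connected (with_proj (coned_cliques m n))"
proof -
  let ?G = "with_proj (coned_cliques m n)"
  interpret pair_graph "coned_cliques m n" by (rule pair_graph_coned_cliques)
  have verts: "pverts (coned_cliques m n) = {..n}" by (simp add: coned_cliques_def)
  have to_n: "(u, n) \<in> parcs (coned_cliques m n)" "(n, u) \<in> parcs (coned_cliques m n)" if "u < n" for u
    using that by (auto simp: coned_cliques_def)
  have "u \<rightarrow>\<^sup>*\<^bsub>?G\<^esub> n \<and> n \<rightarrow>\<^sup>*\<^bsub>?G\<^esub> u" if "u \<le> n" for u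
    using that to_n[of u] verts by (cases "u = n") auto
  then have "u \<rightarrow>\<^sup>*\<^bsub>?G\<^esub> v" if "u \<le> n" "v \<le> n" for u v
    using that reachable_trans[of u n v] by simp
  \<comment> \<open>\<open>connected\<close> is defined through the symmetric closure.\<close>
  then have "u \<rightarrow>\<^sup>*\<^bsub>with_proj (mk_symmetric ?G)\<^esub> v" if "u \<le> n" "v \<le> n" for u v
    using that by (intro reachable_mk_symmetricI) simp
  then show ?thesis
    unfolding Digraph_Component.connected_def strongly_connected_def by (auto simp: verts)
qed

lemma trivially_perfect_coned_cliques:
  assumes "m > 0" "j > 0"
  shows "trivially_perfect (coned_cliques m (j * m))"
proof -
  obtain i where i: "j = Suc i" using assms by (cases j) auto
  let ?B = "{(u, v). u < j * m \<and> v < j * m \<and> u div m = v div m \<and> u \<noteq> v}"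
  have "trivially_perfect \<lparr>pverts = {..<j * m}, parcs = ?B\<rparr>"
    using trivially_perfect_blocks[OF assms(1)] i by blast
  from add_universal_vertex[OF this, of "j * m"]
  have "trivially_perfect \<lparr>pverts = insert (j * m) {..<j * m},
    parcs = ?B \<union> {j * m} \<times> {..<j * m} \<union> {..<j * m} \<times> {j * m}\<rparr>" by simp
  moreover have "insert (j * m) {..<j * m} = {..j * m}" by auto
  moreover have "?B \<union> {j * m} \<times> {..<j * m} \<union> {..<j * m} \<times> {j * m} = parcs (coned_cliques m (j * m))"
    by (auto simp: coned_cliques_def)
  ultimately show ?thesis by (simp add: coned_cliques_def)
qed

section \<open>Tree-depth and number of edges\<close>

text \<open>The apex and the first block form a clique of size \<open>m + 1\<close>. Conversely,
  rooting at the apex leaves components with at most \<open>m\<close> vertices each.\<close>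

lemma tree_depth_coned_cliques:
  assumes "m > 0" "m \<le> n"
  shows "tree_depth (with_proj (coned_cliques m n)) = m + 1"
  unfolding tree_depth_def
proof (rule Least_equality)
  let ?G = "with_proj (coned_cliques m n)"
  note G = pseudo_graph_coned_cliques[of m n]
  have lower: "m + 1 \<le> height T" if "search_tree ?G T" for T
  proof -
    have "card (insert n {..<m}) \<le> height T"
      using assms by (intro card_clique_le_height[OF that G]) (auto simp: coned_cliques_def)
    then show ?thesis using assms by simp
  qed
  \<comment> \<open>The constant priority serves only to obtain some search tree on each
    component.\<close>
  have "\<exists>f. \<forall>C\<in>components ?G n. search_tree C (f C)"
    using search_tree_of_priority[of _ "\<lambda>_. 0 :: nat"] pseudo_graph_component[OF G]
      component_nonempty[OF G] by (intro bchoice) blast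
  then obtain f where f: "\<forall>C\<in>components ?G n. search_tree C (f C)" ..
  obtain ts where ts: "search_tree ?G (Node n ts)" "fset ts = f ` components ?G n"
    by (rule search_tree_children_exist[OF G _ f]) (simp_all add: coned_cliques_def)
  have "height (f C) \<le> m" if C: "C \<in> components ?G n" for C
  proof -
    have C': "pseudo_graph C" using pseudo_graph_component[OF G C] .
    obtain x where x: "x \<in> verts C" using component_nonempty[OF G C] by blast
    have sc: "strongly_connected C" using C by (auto simp: pre_digraph.sccs_def)
    have "x div m = y div m" if "y \<in> verts C" for y
      using component_arcs_ends[OF G C]
      by (intro invariant_on_strongly_connected[OF sc C' x that]) (auto simp: coned_cliques_def)
    then have "verts C \<subseteq> {x div m * m..<Suc (x div m) * m}"
      using div_eq_iff_block[OF assms(1), of _ "x div m"] by (metis subsetI)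
    then have "card (verts C) \<le> card {x div m * m..<Suc (x div m) * m}"
      by (intro card_mono) auto
    moreover have "height (f C) \<le> card (verts C)"
      using f[THEN bspec, OF C] C' by (rule height_le_card)
    ultimately show ?thesis by simp
  qed
  then have "height (Node n ts) \<le> Suc m" unfolding height_Node_le_iff ts(2) by simp
  then have "height (Node n ts) = m + 1" using lower[OF ts(1)] by linarith
  then show "\<exists>T. search_tree ?G T \<and> height T = m + 1" using ts(1) by blast
  show "m + 1 \<le> h" if "\<exists>T. search_tree ?G T \<and> height T = h" for h
    using that lower by blast
qed

text \<open>Each block contributes the sum of all residues, \<open>m * (m - 1) / 2\<close>; doubling
  avoids the division.\<close>

lemma sum_mod_multiple:
  fixes m :: nat
  shows "2 * (\<Sum>x<j * m. x mod m) = j * m * (m - 1)"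
proof (induction j)
  case (Suc j)
  have "(\<Sum>x<Suc j * m. x mod m) = (\<Sum>x<j * m. x mod m) + (\<Sum>x=j * m..<j * m + m. x mod m)"
    by (simp add: lessThan_atLeast0 sum.atLeastLessThan_concat add.commute)
  also have "(\<Sum>x=j * m..<j * m + m. x mod m) = (\<Sum>x<m. x)"
    using sum.shift_bounds_nat_ivl[of "\<lambda>x. x mod m" 0 "j * m" m]
    by (simp add: add.commute lessThan_atLeast0)
  finally show ?case using Suc Sum_Ico_nat[of 0 m]
    by (simp add: lessThan_atLeast0 algebra_simps)
qed simp

text \<open>Edges are counted at their larger end: \<open>x mod m\<close> for a vertex of a block,
  and all \<open>j * m\<close> others for the apex.\<close>

lemma card_edges_coned_cliques:
  assumes "m > 0"
  shows "2 * card {(x, y) \<in> parcs (coned_cliques m (j * m)). y < x} = (m + 1) * (j * m)"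
proof -
  let ?n = "j * m"
  \<comment> \<open>\<open>N x\<close> is the set of smaller neighbours of \<open>x\<close>, namely
    the part of its block before \<open>x\<close>, or everything below the apex.\<close>
  define N where "N x = (if x = ?n then {..<?n} else {x div m * m..<x})" for x
  have "{(x, y) \<in> parcs (coned_cliques m ?n). y < x} = Sigma {..?n} N"
  proof (intro set_eqI, clarify)
    fix x y
    have "x div m = y div m \<longleftrightarrow> x div m * m \<le> y" if "y < x"
      using that div_eq_iff_block[OF assms, of y "x div m"] div_eq_iff_block[OF assms, of x "x div m"]
      by auto
    then show "(x, y) \<in> {(x, y) \<in> parcs (coned_cliques m ?n). y < x} \<longleftrightarrow> (x, y) \<in> Sigma {..?n} N"
      by (auto simp: coned_cliques_def N_def)
  qed
  then have "card {(x, y) \<in> parcs (coned_cliques m ?n). y < x} = (\<Sum>x\<le>?n. card (N x))"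
    by (simp add: N_def)
  also have "\<dots> = (\<Sum>x<?n. card (N x)) + ?n"
    by (simp add: N_def flip: lessThan_Suc_atMost)
  also have "(\<Sum>x<?n. card (N x)) = (\<Sum>x<?n. x mod m)"
    by (rule sum.cong) (auto simp: N_def minus_div_mult_eq_mod)
  finally have "2 * card {(x, y) \<in> parcs (coned_cliques m ?n). y < x} = ?n * (m - 1) + 2 * ?n"
    using sum_mod_multiple[of m j] by simp
  \<comment> \<open>Positivity of \<open>m\<close> keeps the truncated \<open>m - 1\<close>
    honest.\<close>
  also have "\<dots> = (m + 1) * ?n" using assms by (cases m) (auto simp: algebra_simps)
  finally show ?thesis .
qed

theorem theorem14:
  fixes k n :: nat
  assumes "k > 0" and "n > 0" and "k dvd n"
  shows "\<exists>G :: nat pair_pre_digraph.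
           pair_graph G \<and> connected (with_proj G) \<and> trivially_perfect G \<and>
           card (pverts G) = n + 1 \<and>
           tree_depth (with_proj G) = n div k + 1 \<and>
           associahedron_diameter (with_proj G) \<ge>
             ereal (real (tree_depth (with_proj G)) * real n / 2)"
proof -
  \<comment> \<open>\<open>m\<close> is the clique size, so that \<open>k\<close> cliques fill the
    \<open>n\<close> vertices other than the apex.\<close>
  define m where "m = n div k"
  have n: "n = k * m" and m: "m > 0" "m \<le> n"
    using assms by (auto simp: m_def dvd_div_eq_0_iff)
  let ?G = "coned_cliques m n"
  \<comment> \<open>Taking each vertex's own number as its priority leaves no ties, so every edge is
    counted exactly once.\<close>
  let ?E = "{(x, y) \<in> arcs_ends (with_proj ?G). int y < int x}"
  have td: "tree_depth (with_proj ?G) = m + 1" by (rule tree_depth_coned_cliques[OF m])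
  have "2 * card ?E = (m + 1) * n"
    using card_edges_coned_cliques[OF m(1), of k] n by simp
  then have "real (2 * card ?E) = real ((m + 1) * n)" by (rule arg_cong)
  then have "real (card ?E) = real (m + 1) * real n / 2"
    by (simp add: algebra_simps)
  moreover have "ereal (real (card ?E)) \<le> associahedron_diameter (with_proj ?G)"
    by (rule card_edges_le_associahedron_diameter[OF pseudo_graph_coned_cliques])
      (auto simp: coned_cliques_def)
  ultimately have "ereal (real (tree_depth (with_proj ?G)) * real n / 2) \<le>
      associahedron_diameter (with_proj ?G)"
    by (simp only: td)
  moreover have "trivially_perfect ?G" unfolding n
    using trivially_perfect_coned_cliques m(1) assms(1) by blast
  moreover have "card (pverts ?G) = n + 1" by (simp add: coned_cliques_def)
  ultimately show ?thesis
    using pair_graph_coned_cliques connected_coned_cliques td m_def by blast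
qed

end
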